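(* The logic $\mathbf{Grz}$ enjoys the uniform Lyndon interpolation property. Moreover, for any formula $\varphi$ and any finite sets $P,Q$ of propositional variables there exists a uniform Lyndon interpolant $\theta$ of $(\varphi,P,Q)$ in $\mathbf{Grz}$ with $d(\theta)\le 3n(\varphi)+3$.
   Context: Formulas are built from countably many propositional variables, $\bot$, $\to$ and $\Box$ (other connectives are abbreviations). Modal depth: $d(p)=d(\bot)=0$, $d(\varphi\to\psi)=\max\{d(\varphi),d(\psi)\}$, $d(\Box\varphi)=d(\varphi)+1$. Positive/negative variable sets: $v^+(p)=\{p\}$, $v^-(p)=\emptyset$; $v^\pm(\bot)=\emptyset$; $v^+(\psi\to\theta)=v^-(\psi)\cup v^+(\theta)$, $v^-(\psi\to\theta)=v^+(\psi)\cup v^-(\theta)$; $v^\pm(\Box\psi)=v^\pm(\psi)$. $\mathrm{Sub}(\varphi)$ is the set of subformulas of $\varphi$ and $n(\varphi)=|\{\psi:\Box\psi\in\mathrm{Sub}(\varphi)\}|$. A normal logic is a set of formulas containing all tautologies and $\Box(p\to q)\to(\Box p\to\Box q)$, closed under modus ponens, necessitation and uniform substitution; $L\vdash\varphi$ means $\varphi\in L$. $\mathbf{Grz}$ is the least normal logic containing $\Box(\Box(p\to\Box p)\to p)\to p$. For a normal logic $L$, formula $\varphi$ and finite sets $P,Q$ of variables, a uniform Lyndon interpolant of $(\varphi,P,Q)$ in $L$ is a formula $\theta$ with $v^+(\theta)\subseteq v^+(\varphi)\setminus P$, $v^-(\theta)\subseteq v^-(\varphi)\setminus Q$, $L\vdash\varphi\to\theta$,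 and such that $L\vdash\theta\to\psi$ for every $\psi$ with $v^+(\psi)\cap P=v^-(\psi)\cap Q=\emptyset$ and $L\vdash\varphi\to\psi$. $L$ enjoys the uniform Lyndon interpolation property if such an interpolant exists for all $\varphi,P,Q$. *)

theory Defs
  imports Main
begin

datatype fm =
    Var nat
  | Bot  ("\<^bold>\<bottom>")
  | Imp fm fm  (infixr "\<^bold>\<rightarrow>" 55)
  | Box fm  ("\<^bold>\<box> _" [70] 70)

primrec mdepth :: "fm \<Rightarrow> nat" where
  "mdepth (Var p) = 0"
| "mdepth \<^bold>\<bottom> = 0"
| "mdepth (A \<^bold>\<rightarrow> B) = max (mdepth A) (mdepth B)"
| "mdepth (\<^bold>\<box> A) = mdepth A + 1"

fun vpos :: "fm \<Rightarrow> nat set" and vneg :: "fm \<Rightarrow> nat set" where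
  "vpos (Var p) = {p}"
| "vpos \<^bold>\<bottom> = {}"
| "vpos (A \<^bold>\<rightarrow> B) = vneg A \<union> vpos B"
| "vpos (\<^bold>\<box> A) = vpos A"
| "vneg (Var p) = {}"
| "vneg \<^bold>\<bottom> = {}"
| "vneg (A \<^bold>\<rightarrow> B) = vpos A \<union> vneg B"
| "vneg (\<^bold>\<box> A) = vneg A"

primrec Sub :: "fm \<Rightarrow> fm set" where
  "Sub (Var p) = {Var p}"
| "Sub \<^bold>\<bottom> = {\<^bold>\<bottom>}"
| "Sub (A \<^bold>\<rightarrow> B) = {A \<^bold>\<rightarrow> B} \<union> Sub A \<union> Sub B"
| "Sub (\<^bold>\<box> A) = {\<^bold>\<box> A} \<union> Sub A"

definition nbox :: "fm \<Rightarrow> nat" where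
  "nbox A = card {B. \<^bold>\<box> B \<in> Sub A}"

lemma finite_Sub: "finite (Sub A)"
  by (induction A) auto

lemma finite_boxed_Sub: "finite {B. \<^bold>\<box> B \<in> Sub A}"
  using finite_vimageI[OF finite_Sub, of Box A] by (auto simp: inj_def vimage_def)

primrec subst :: "(nat \<Rightarrow> fm) \<Rightarrow> fm \<Rightarrow> fm" where
  "subst s (Var p) = s p"
| "subst s \<^bold>\<bottom> = \<^bold>\<bottom>"
| "subst s (A \<^bold>\<rightarrow> B) = subst s A \<^bold>\<rightarrow> subst s B"
| "subst s (\<^bold>\<box> A) = \<^bold>\<box> (subst s A)"

text \<open>Classical propositional evaluation: variables and boxed formulas are both treated as
  atoms, the first argument interpreting the former and the second the latter.\<close>

primrec peval :: "(nat \<Rightarrow> bool) \<Rightarrow> (fm \<Rightarrow> bool) \<Rightarrow> fm \<Rightarrow> bool" where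
  "peval v w (Var p) = v p"
| "peval v w \<^bold>\<bottom> = False"
| "peval v w (A \<^bold>\<rightarrow> B) = (peval v w A \<longrightarrow> peval v w B)"
| "peval v w (\<^bold>\<box> A) = w A"

definition tautology :: "fm \<Rightarrow> bool" where
  "tautology A \<longleftrightarrow> (\<forall>v w. peval v w A)"

definition normal_logic :: "fm set \<Rightarrow> bool" where
  "normal_logic L \<longleftrightarrow>
     (\<forall>A. tautology A \<longrightarrow> A \<in> L) \<and>
     \<^bold>\<box> (Var 0 \<^bold>\<rightarrow> Var 1) \<^bold>\<rightarrow> (\<^bold>\<box> (Var 0) \<^bold>\<rightarrow> \<^bold>\<box> (Var 1)) \<in> L \<and>
     (\<forall>A B. A \<in> L \<longrightarrow> A \<^bold>\<rightarrow> B \<in> L \<longrightarrow> B \<in> L) \<and>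
     (\<forall>A. A \<in> L \<longrightarrow> \<^bold>\<box> A \<in> L) \<and>
     (\<forall>A s. A \<in> L \<longrightarrow> subst s A \<in> L)"

definition Grz_axiom :: fm where
  "Grz_axiom = \<^bold>\<box> (\<^bold>\<box> (Var 0 \<^bold>\<rightarrow> \<^bold>\<box> (Var 0)) \<^bold>\<rightarrow> Var 0) \<^bold>\<rightarrow> Var 0"

definition Grz :: "fm set" where
  "Grz = \<Inter> {L. normal_logic L \<and> Grz_axiom \<in> L}"

lemma normal_logic_Grz: "normal_logic Grz"
  unfolding Grz_def normal_logic_def by blast

lemma Grz_axiom_in_Grz: "Grz_axiom \<in> Grz"
  by (simp add: Grz_def)

lemma Grz_least: "normal_logic L \<Longrightarrow> Grz_axiom \<in> L \<Longrightarrow> Grz \<subseteq> L"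
  by (auto simp: Grz_def)

definition uniform_Lyndon_interpolant ::
    "fm set \<Rightarrow> fm \<Rightarrow> nat set \<Rightarrow> nat set \<Rightarrow> fm \<Rightarrow> bool" where
  "uniform_Lyndon_interpolant L A P Q C \<longleftrightarrow>
     vpos C \<subseteq> vpos A - P \<and>
     vneg C \<subseteq> vneg A - Q \<and>
     A \<^bold>\<rightarrow> C \<in> L \<and>
     (\<forall>B. vpos B \<inter> P = {} \<longrightarrow> vneg B \<inter> Q = {} \<longrightarrow> A \<^bold>\<rightarrow> B \<in> L \<longrightarrow> C \<^bold>\<rightarrow> B \<in> L)"

definition uniform_Lyndon_interpolation :: "fm set \<Rightarrow> bool" where
  "uniform_Lyndon_interpolation L \<longleftrightarrow>
     (\<forall>A P Q. finite P \<longrightarrow> finite Q \<longrightarrow> (\<exists>C. uniform_Lyndon_interpolant L A P Q C))"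

end

theory Submission
  imports Defs
begin

text \<open>Grz is the logic of finite partial orders. Let \<open>N = 3 n(A) + 1\<close>. Up to equivalence there are
  finitely many formulas of depth at most \<open>N\<close> over finite sets of variables, so \<open>A\<close> has a strongest
  consequence \<open>C\<close> among those that satisfy the polarity constraints. If \<open>C \<rightarrow> B\<close> fails at a point
  \<open>y\<close>, then by the choice of \<open>C\<close> some point \<open>x\<close> satisfies \<open>A\<close> and every such formula true at \<open>x\<close>
  is true at \<open>y\<close>. This \<open>N\<close>-layered directed simulation is unfolded into a finite partial order of
  pairs \<open>(x', y')\<close> whose first components decide the subformulas of \<open>A\<close> and whose second
  components decide \<open>B\<close>. It has enough layers, because three layers suffice between two changes in
  the set of those \<open>\<box>D \<in> Sub A\<close> that fail at the first component, and this set can shrink at most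
  \<open>n(A)\<close> times.\<close>

section \<open>Formulas of bounded depth\<close>

abbreviation Neg :: "fm \<Rightarrow> fm" where
  "Neg A \<equiv> A \<^bold>\<rightarrow> \<^bold>\<bottom>"

primrec Conj :: "fm list \<Rightarrow> fm" where
  "Conj [] = Neg \<^bold>\<bottom>"
| "Conj (A # As) = Neg (A \<^bold>\<rightarrow> Neg (Conj As))"

definition bounded_fms :: "nat \<Rightarrow> nat set \<Rightarrow> nat set \<Rightarrow> fm set" where
  "bounded_fms k S T = {A. mdepth A \<le> k \<and> vpos A \<subseteq> S \<and> vneg A \<subseteq> T}"

lemma bounded_fms_mono: "k \<le> l \<Longrightarrow> bounded_fms k S T \<subseteq> bounded_fms l S T"
  by (auto simp: bounded_fms_def)

lemma Neg_bounded_fms_iff [simp]: "Neg A \<in> bounded_fms k S T \<longleftrightarrow> A \<in> bounded_fms k T S"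
  by (auto simp: bounded_fms_def)

lemma Box_bounded_fms_iff [simp]:
  "\<^bold>\<box> A \<in> bounded_fms (Suc k) S T \<longleftrightarrow> A \<in> bounded_fms k S T"
  by (simp add: bounded_fms_def)

lemma Conj_bounded_fms: "set As \<subseteq> bounded_fms k S T \<Longrightarrow> Conj As \<in> bounded_fms k S T"
  by (induction As) (auto simp: bounded_fms_def)

lemma finite_vpos_vneg: "finite (vpos A)" "finite (vneg A)"
  by (induction A) auto

section \<open>Maximal consistent sets of normal logics\<close>

locale normal_modal_logic =
  fixes L :: "fm set"
  assumes normal_logic: "normal_logic L"
begin

lemma tautology_mem: "tautology A \<Longrightarrow> A \<in> L"
  using normal_logic unfolding normal_logic_def by blast

lemma mp_mem: "A \<^bold>\<rightarrow> B \<in> L \<Longrightarrow> A \<in> L \<Longrightarrow> B \<in> L"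
  using normal_logic unfolding normal_logic_def by blast

lemma nec_mem: "A \<in> L \<Longrightarrow> \<^bold>\<box> A \<in> L"
  using normal_logic unfolding normal_logic_def by blast

lemma subst_mem: "A \<in> L \<Longrightarrow> subst s A \<in> L"
  using normal_logic unfolding normal_logic_def by blast

lemma K_mem: "\<^bold>\<box> (A \<^bold>\<rightarrow> B) \<^bold>\<rightarrow> \<^bold>\<box> A \<^bold>\<rightarrow> \<^bold>\<box> B \<in> L"
proof -
  have "\<^bold>\<box> (Var 0 \<^bold>\<rightarrow> Var 1) \<^bold>\<rightarrow> \<^bold>\<box> (Var 0) \<^bold>\<rightarrow> \<^bold>\<box> (Var 1) \<in> L"
    using normal_logic unfolding normal_logic_def by blast
  from subst_mem[OF this, of "\<lambda>p. if p = 0 then A else B"] show ?thesis by simp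
qed

lemma Box_mono_mem: "A \<^bold>\<rightarrow> B \<in> L \<Longrightarrow> \<^bold>\<box> A \<^bold>\<rightarrow> \<^bold>\<box> B \<in> L"
  by (rule mp_mem[OF K_mem nec_mem])

inductive derives :: "fm set \<Rightarrow> fm \<Rightarrow> bool"  (infix "\<turnstile>" 50) for G where
  theorem_of: "A \<in> L \<Longrightarrow> G \<turnstile> A"
| hypothesis: "A \<in> G \<Longrightarrow> G \<turnstile> A"
| modus_ponens: "G \<turnstile> A \<^bold>\<rightarrow> B \<Longrightarrow> G \<turnstile> A \<Longrightarrow> G \<turnstile> B"

lemma derives_tautology: "tautology A \<Longrightarrow> G \<turnstile> A"
  by (rule theorem_of[OF tautology_mem])

lemma derives_empty_iff: "{} \<turnstile> A \<longleftrightarrow> A \<in> L"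
proof
  show "{} \<turnstile> A \<Longrightarrow> A \<in> L" by (induction rule: derives.induct) (auto intro: mp_mem)
qed (rule theorem_of)

lemma derives_mono: "G \<turnstile> A \<Longrightarrow> G \<subseteq> H \<Longrightarrow> H \<turnstile> A"
  by (induction rule: derives.induct) (auto intro: derives.intros)

lemma deduction_theorem: "insert A G \<turnstile> B \<Longrightarrow> G \<turnstile> A \<^bold>\<rightarrow> B"
proof (induction rule: derives.induct)
  case (theorem_of B)
  have "G \<turnstile> B \<^bold>\<rightarrow> A \<^bold>\<rightarrow> B" by (rule derives_tautology) (simp add: tautology_def)
  then show ?case using modus_ponens derives.theorem_of[OF theorem_of] by blast
next
  case (hypothesis B)
  have "G \<turnstile> B \<^bold>\<rightarrow> A \<^bold>\<rightarrow> B" "G \<turnstile> A \<^bold>\<rightarrow> A"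
    by (rule derives_tautology, simp add: tautology_def)+
  then show ?case using modus_ponens derives.hypothesis hypothesis by blast
next
  case (modus_ponens B C)
  have "G \<turnstile> (A \<^bold>\<rightarrow> B \<^bold>\<rightarrow> C) \<^bold>\<rightarrow> (A \<^bold>\<rightarrow> B) \<^bold>\<rightarrow> A \<^bold>\<rightarrow> C"
    by (rule derives_tautology) (simp add: tautology_def)
  then show ?case using modus_ponens.IH derives.modus_ponens by blast
qed

lemma derives_finite: "G \<turnstile> A \<Longrightarrow> \<exists>F\<subseteq>G. finite F \<and> F \<turnstile> A"
proof (induction rule: derives.induct)
  case (theorem_of A)
  then show ?case using derives.theorem_of by blast
next
  case (hypothesis A)
  then show ?case using derives.hypothesis[of A "{A}"] by blast
next
  case (modus_ponens A B)
  then obtain F H where "F \<subseteq> G" "finite F" "F \<turnstile> A \<^bold>\<rightarrow> B" "H \<subseteq> G" "finite H" "H \<turnstile> A" by blast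
  then have "F \<union> H \<turnstile> B" "F \<union> H \<subseteq> G" "finite (F \<union> H)"
    using derives_mono derives.modus_ponens[of "F \<union> H" A B] by auto
  then show ?case by blast
qed

definition consistent :: "fm set \<Rightarrow> bool" where
  "consistent G \<longleftrightarrow> \<not> G \<turnstile> \<^bold>\<bottom>"

definition maximal_consistent :: "fm set \<Rightarrow> bool" where
  "maximal_consistent \<Gamma> \<longleftrightarrow> consistent \<Gamma> \<and> (\<forall>A. consistent (insert A \<Gamma>) \<longrightarrow> A \<in> \<Gamma>)"

lemma consistent_Union_chain:
  assumes "\<C> \<noteq> {}" "subset.chain (Collect consistent) \<C>"
  shows "consistent (\<Union>\<C>)"
  unfolding consistent_def
proof
  assume "\<Union>\<C> \<turnstile> \<^bold>\<bottom>"
  then obtain F where F: "F \<subseteq> \<Union>\<C>" "finite F" "F \<turnstile> \<^bold>\<bottom>" using derives_finite by blast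
  obtain H where H: "H \<in> \<C>" "F \<subseteq> H" using finite_subset_Union_chain[OF F(2,1) assms] .
  have "consistent H" using assms(2) H(1) by (auto simp: subset_chain_def)
  then show False using derives_mono[OF F(3) H(2)] by (simp add: consistent_def)
qed

lemma Lindenbaum:
  assumes "consistent G"
  obtains \<Gamma> where "G \<subseteq> \<Gamma>" "maximal_consistent \<Gamma>"
proof -
  let ?\<A> = "{H. G \<subseteq> H \<and> consistent H}"
  have "\<exists>\<Gamma>\<in>?\<A>. \<forall>H\<in>?\<A>. \<Gamma> \<subseteq> H \<longrightarrow> H = \<Gamma>"
  proof (rule subset_Zorn_nonempty)
    show "?\<A> \<noteq> {}" using assms by blast
  next
    fix \<C> assume \<C>: "\<C> \<noteq> {}" "subset.chain ?\<A> \<C>"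
    then have "subset.chain (Collect consistent) \<C>" by (auto simp: subset_chain_def)
    then have "consistent (\<Union>\<C>)" using consistent_Union_chain \<C>(1) by blast
    moreover have "G \<subseteq> \<Union>\<C>" using \<C> unfolding subset_chain_def by blast
    ultimately show "\<Union>\<C> \<in> ?\<A>" by blast
  qed
  then obtain \<Gamma> where \<Gamma>: "G \<subseteq> \<Gamma>" "consistent \<Gamma>"
    and maximal: "\<forall>H\<in>?\<A>. \<Gamma> \<subseteq> H \<longrightarrow> H = \<Gamma>" by auto
  have "A \<in> \<Gamma>" if "consistent (insert A \<Gamma>)" for A
    using that \<Gamma>(1) maximal[rule_format, of "insert A \<Gamma>"] by blast
  then have "maximal_consistent \<Gamma>" using \<Gamma>(2) by (simp add: maximal_consistent_def)
  with \<Gamma>(1) show thesis by (rule that)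
qed

lemma derives_Neg_if_notin_maximal_consistent:
  assumes "maximal_consistent \<Gamma>" "A \<notin> \<Gamma>"
  shows "\<Gamma> \<turnstile> Neg A"
proof (rule deduction_theorem)
  show "insert A \<Gamma> \<turnstile> \<^bold>\<bottom>" using assms by (auto simp: maximal_consistent_def consistent_def)
qed

lemma maximal_consistent_closed:
  assumes "maximal_consistent \<Gamma>" "\<Gamma> \<turnstile> A"
  shows "A \<in> \<Gamma>"
proof (rule ccontr)
  assume "A \<notin> \<Gamma>"
  then have "\<Gamma> \<turnstile> Neg A" by (rule derives_Neg_if_notin_maximal_consistent[OF assms(1)])
  then have "\<Gamma> \<turnstile> \<^bold>\<bottom>" using assms(2) by (rule modus_ponens)
  then show False using assms(1) by (simp add: maximal_consistent_def consistent_def)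
qed

lemma Bot_notin_maximal_consistent: "maximal_consistent \<Gamma> \<Longrightarrow> \<^bold>\<bottom> \<notin> \<Gamma>"
  by (auto simp: maximal_consistent_def consistent_def intro: hypothesis)

lemma Imp_mem_maximal_consistent_iff:
  assumes \<Gamma>: "maximal_consistent \<Gamma>"
  shows "A \<^bold>\<rightarrow> B \<in> \<Gamma> \<longleftrightarrow> (A \<in> \<Gamma> \<longrightarrow> B \<in> \<Gamma>)"
proof
  assume "A \<^bold>\<rightarrow> B \<in> \<Gamma>"
  then show "A \<in> \<Gamma> \<longrightarrow> B \<in> \<Gamma>"
    using maximal_consistent_closed[OF \<Gamma>] modus_ponens hypothesis by blast
next
  assume "A \<in> \<Gamma> \<longrightarrow> B \<in> \<Gamma>"
  then have "\<Gamma> \<turnstile> Neg A \<or> \<Gamma> \<turnstile> B"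
    using derives_Neg_if_notin_maximal_consistent[OF \<Gamma>] hypothesis by blast
  moreover have "\<Gamma> \<turnstile> Neg A \<^bold>\<rightarrow> A \<^bold>\<rightarrow> B" "\<Gamma> \<turnstile> B \<^bold>\<rightarrow> A \<^bold>\<rightarrow> B"
    by (rule derives_tautology, simp add: tautology_def)+
  ultimately show "A \<^bold>\<rightarrow> B \<in> \<Gamma>"
    using maximal_consistent_closed[OF \<Gamma>] modus_ponens by blast
qed

lemmas maximal_consistent_simps = Bot_notin_maximal_consistent Imp_mem_maximal_consistent_iff

lemma Conj_mem_maximal_consistent_iff:
  "maximal_consistent \<Gamma> \<Longrightarrow> Conj As \<in> \<Gamma> \<longleftrightarrow> set As \<subseteq> \<Gamma>"
  by (induction As) (simp_all add: maximal_consistent_simps)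

lemma logic_subset_maximal_consistent: "maximal_consistent \<Gamma> \<Longrightarrow> A \<in> L \<Longrightarrow> A \<in> \<Gamma>"
  using maximal_consistent_closed theorem_of by blast

lemma maximal_consistent_Imp_theoremD:
  assumes "A \<^bold>\<rightarrow> B \<in> L" "maximal_consistent \<Gamma>" "A \<in> \<Gamma>"
  shows "B \<in> \<Gamma>"
  using logic_subset_maximal_consistent[OF assms(2,1)] assms(2,3)
  by (simp add: maximal_consistent_simps)

lemma mem_if_in_all_maximal_consistent:
  assumes "\<And>\<Gamma>. maximal_consistent \<Gamma> \<Longrightarrow> A \<in> \<Gamma>"
  shows "A \<in> L"
proof (rule ccontr)
  assume "A \<notin> L"
  have "consistent {Neg A}"
    unfolding consistent_def
  proof
    assume "{Neg A} \<turnstile> \<^bold>\<bottom>"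
    then have "{} \<turnstile> Neg (Neg A)" by (rule deduction_theorem)
    moreover have "{} \<turnstile> Neg (Neg A) \<^bold>\<rightarrow> A" by (rule derives_tautology) (simp add: tautology_def)
    ultimately show False using modus_ponens derives_empty_iff \<open>A \<notin> L\<close> by blast
  qed
  then obtain \<Gamma> where "{Neg A} \<subseteq> \<Gamma>" "maximal_consistent \<Gamma>" by (rule Lindenbaum)
  then show False using assms[of \<Gamma>] by (auto simp: maximal_consistent_simps)
qed

section \<open>Finitely many formulas of bounded depth up to equivalence\<close>

definition proof_set :: "fm \<Rightarrow> fm set set" where
  "proof_set A = {\<Gamma>. maximal_consistent \<Gamma> \<and> A \<in> \<Gamma>}"

lemma proof_set_subset_iff: "proof_set A \<subseteq> proof_set B \<longleftrightarrow> A \<^bold>\<rightarrow> B \<in> L"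
proof -
  have "A \<^bold>\<rightarrow> B \<in> L \<longleftrightarrow> (\<forall>\<Gamma>. maximal_consistent \<Gamma> \<longrightarrow> A \<^bold>\<rightarrow> B \<in> \<Gamma>)"
    using mem_if_in_all_maximal_consistent logic_subset_maximal_consistent by blast
  then show ?thesis by (auto simp: proof_set_def Imp_mem_maximal_consistent_iff)
qed

lemma proof_set_Box_cong:
  assumes "proof_set A = proof_set B"
  shows "proof_set (\<^bold>\<box> A) = proof_set (\<^bold>\<box> B)"
proof
  show "proof_set (\<^bold>\<box> A) \<subseteq> proof_set (\<^bold>\<box> B)" "proof_set (\<^bold>\<box> B) \<subseteq> proof_set (\<^bold>\<box> A)"
    unfolding proof_set_subset_iff
    by (rule Box_mono_mem, simp add: assms flip: proof_set_subset_iff)+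
qed

definition fms_below :: "nat \<Rightarrow> nat set \<Rightarrow> fm set" where
  "fms_below k U = {A. mdepth A < k \<and> vpos A \<union> vneg A \<subseteq> U}"

definition modal_type :: "nat \<Rightarrow> nat set \<Rightarrow> fm set \<Rightarrow> nat set \<times> fm set set set" where
  "modal_type k U \<Gamma> = ({p \<in> U. Var p \<in> \<Gamma>}, proof_set ` {C \<in> fms_below k U. \<^bold>\<box> C \<in> \<Gamma>})"

lemma Box_mem_iff_modal_type:
  assumes "C \<in> fms_below k U" "maximal_consistent \<Gamma>"
  shows "\<^bold>\<box> C \<in> \<Gamma> \<longleftrightarrow> proof_set C \<in> snd (modal_type k U \<Gamma>)"
proof
  assume "\<^bold>\<box> C \<in> \<Gamma>"
  then show "proof_set C \<in> snd (modal_type k U \<Gamma>)" using assms(1) by (simp add: modal_type_def)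
next
  assume "proof_set C \<in> snd (modal_type k U \<Gamma>)"
  then obtain D where D: "proof_set C = proof_set D" "\<^bold>\<box> D \<in> \<Gamma>" by (auto simp: modal_type_def)
  then have "\<Gamma> \<in> proof_set (\<^bold>\<box> D)" using assms(2) by (simp add: proof_set_def)
  then have "\<Gamma> \<in> proof_set (\<^bold>\<box> C)" using proof_set_Box_cong[OF D(1)] by simp
  then show "\<^bold>\<box> C \<in> \<Gamma>" by (simp add: proof_set_def)
qed

lemma mem_iff_if_modal_type_eq:
  assumes "maximal_consistent \<Gamma>" "maximal_consistent \<Delta>" "modal_type k U \<Gamma> = modal_type k U \<Delta>"
  shows "A \<in> fms_below (Suc k) U \<Longrightarrow> A \<in> \<Gamma> \<longleftrightarrow> A \<in> \<Delta>"
proof (induction A)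
  case (Var p)
  then show ?case using assms(3) by (auto simp: modal_type_def fms_below_def)
next
  case (Box C)
  then have "C \<in> fms_below k U" by (simp add: fms_below_def)
  then show ?case using assms by (simp add: Box_mem_iff_modal_type)
qed (use assms(1,2) in \<open>simp_all add: maximal_consistent_simps fms_below_def\<close>)

lemma proof_set_eq_modal_type_preimage:
  assumes "A \<in> fms_below (Suc k) U"
  shows "proof_set A =
    {\<Gamma>. maximal_consistent \<Gamma> \<and> modal_type k U \<Gamma> \<in> modal_type k U ` proof_set A}"
  using mem_iff_if_modal_type_eq[OF _ _ _ assms] by (auto simp: proof_set_def)

lemma finite_proof_sets:
  assumes "finite U"
  shows "finite (proof_set ` fms_below k U)"
proof (induction k)
  case 0
  then show ?case by (simp add: fms_below_def)
next
  case (Suc k)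
  let ?types = "\<lambda>X. modal_type k U ` X"
  have "?types ` proof_set ` fms_below (Suc k) U \<subseteq> Pow (Pow U \<times> Pow (proof_set ` fms_below k U))"
    by (auto simp: modal_type_def)
  then have "finite (?types ` proof_set ` fms_below (Suc k) U)"
    by (rule finite_subset) (simp add: Suc.IH assms)
  moreover have "inj_on ?types (proof_set ` fms_below (Suc k) U)"
  proof (intro inj_onI, elim imageE, hypsubst)
    fix A B
    assume A: "A \<in> fms_below (Suc k) U" and B: "B \<in> fms_below (Suc k) U"
      and eq: "?types (proof_set A) = ?types (proof_set B)"
    show "proof_set A = proof_set B"
      using proof_set_eq_modal_type_preimage[OF A, unfolded eq]
        proof_set_eq_modal_type_preimage[OF B] by (rule trans[OF _ sym])
  qed
  ultimately show ?case by (rule finite_imageD)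
qed

lemma finite_axiomatization_bounded_fms:
  assumes "finite S" "finite T" "G \<subseteq> bounded_fms k S T"
  obtains Cs where "set Cs \<subseteq> G" "\<And>D. D \<in> G \<Longrightarrow> Conj Cs \<^bold>\<rightarrow> D \<in> L"
proof -
  have "G \<subseteq> fms_below (Suc k) (S \<union> T)"
    using assms(3) by (auto simp: bounded_fms_def fms_below_def)
  then have "finite (proof_set ` G)"
    by (rule finite_subset[OF image_mono finite_proof_sets]) (simp add: assms(1,2))
  from finite_subset_image[OF this subset_refl] obtain F
    where F: "F \<subseteq> G" "finite F" "proof_set ` G = proof_set ` F" by blast
  obtain Cs where Cs: "set Cs = F" using finite_list[OF F(2)] by blast
  have "Conj Cs \<^bold>\<rightarrow> D \<in> L" if "D \<in> G" for D
  proof -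
    from that F(3) obtain E where E: "E \<in> F" "proof_set D = proof_set E" by blast
    have "proof_set (Conj Cs) \<subseteq> proof_set E"
      using E(1) Cs by (auto simp: proof_set_def Conj_mem_maximal_consistent_iff)
    then show ?thesis unfolding E(2)[symmetric] proof_set_subset_iff .
  qed
  with Cs F(1) show thesis using that by blast
qed

lemma strongest_bounded_consequence:
  assumes "finite S" "finite T"
  obtains C where "C \<in> bounded_fms k S T" "A \<^bold>\<rightarrow> C \<in> L"
    and "\<And>D. D \<in> bounded_fms k S T \<Longrightarrow> A \<^bold>\<rightarrow> D \<in> L \<Longrightarrow> C \<^bold>\<rightarrow> D \<in> L"
proof -
  let ?G = "{D \<in> bounded_fms k S T. A \<^bold>\<rightarrow> D \<in> L}"
  obtain Cs where Cs: "set Cs \<subseteq> ?G" "\<And>D. D \<in> ?G \<Longrightarrow> Conj Cs \<^bold>\<rightarrow> D \<in> L"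
    using finite_axiomatization_bounded_fms[OF assms, of ?G k] by blast
  have "A \<^bold>\<rightarrow> Conj Cs \<in> L"
  proof (rule mem_if_in_all_maximal_consistent)
    fix \<Gamma> assume \<Gamma>: "maximal_consistent \<Gamma>"
    then have "A \<^bold>\<rightarrow> D \<in> \<Gamma>" if "D \<in> set Cs" for D
      using that Cs(1) logic_subset_maximal_consistent by blast
    then show "A \<^bold>\<rightarrow> Conj Cs \<in> \<Gamma>"
      using \<Gamma> by (auto simp: Imp_mem_maximal_consistent_iff Conj_mem_maximal_consistent_iff)
  qed
  moreover have "Conj Cs \<in> bounded_fms k S T" using Cs(1) by (intro Conj_bounded_fms) blast
  ultimately show thesis using that Cs(2) by blast
qed

end

section \<open>Completeness of Grz for finite partial orders\<close>

record 'w kripke_model =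
  worlds :: "'w set"
  rel :: "'w \<Rightarrow> 'w \<Rightarrow> bool"
  val :: "'w \<Rightarrow> nat \<Rightarrow> bool"

primrec sat :: "'w kripke_model \<Rightarrow> 'w \<Rightarrow> fm \<Rightarrow> bool"  ("_, _ \<Turnstile> _" [51, 51, 51] 50) where
  "M, x \<Turnstile> Var p \<longleftrightarrow> val M x p"
| "M, x \<Turnstile> \<^bold>\<bottom> \<longleftrightarrow> False"
| "M, x \<Turnstile> A \<^bold>\<rightarrow> B \<longleftrightarrow> (M, x \<Turnstile> A \<longrightarrow> M, x \<Turnstile> B)"
| "M, x \<Turnstile> \<^bold>\<box> A \<longleftrightarrow> (\<forall>y\<in>worlds M. rel M x y \<longrightarrow> M, y \<Turnstile> A)"

lemma sat_Conj [simp]: "M, x \<Turnstile> Conj As \<longleftrightarrow> (\<forall>A\<in>set As. M, x \<Turnstile> A)"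
  by (induction As) auto

lemma sat_subst: "M, x \<Turnstile> subst s A \<longleftrightarrow> M\<lparr>val := \<lambda>y p. M, y \<Turnstile> s p\<rparr>, x \<Turnstile> A"
  by (induction A arbitrary: x) auto

lemma sat_iff_peval: "M, x \<Turnstile> A \<longleftrightarrow> peval (val M x) (\<lambda>B. M, x \<Turnstile> \<^bold>\<box> B) A"
  by (induction A) auto

definition frame_valid :: "'w kripke_model \<Rightarrow> fm set" where
  "frame_valid M = {A. \<forall>V. \<forall>x\<in>worlds M. M\<lparr>val := V\<rparr>, x \<Turnstile> A}"

lemma normal_logic_frame_valid: "normal_logic (frame_valid M)"
  unfolding normal_logic_def
proof (intro conjI allI impI)
  fix A assume "tautology A"
  then show "A \<in> frame_valid M"
    by (simp add: frame_valid_def tautology_def sat_iff_peval[of _ _ A])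
next
  fix A s assume "A \<in> frame_valid M"
  then show "subst s A \<in> frame_valid M" by (simp add: frame_valid_def sat_subst)
qed (auto simp: frame_valid_def)

lemma frame_validD:
  assumes "A \<in> frame_valid M" "x \<in> worlds M"
  shows "M, x \<Turnstile> A"
proof -
  have "M\<lparr>val := val M\<rparr>, x \<Turnstile> A" using assms by (simp only: frame_valid_def) blast
  then show ?thesis by simp
qed

locale finite_poset_model =
  fixes M :: "'w kripke_model"
  assumes finite_worlds: "finite (worlds M)"
    and reflp_on_rel: "reflp_on (worlds M) (rel M)"
    and transp_on_rel: "transp_on (worlds M) (rel M)"
    and antisymp_on_rel: "antisymp_on (worlds M) (rel M)"
begin

lemmas rel_refl = reflp_onD[OF reflp_on_rel]
  and rel_trans = transp_onD[OF transp_on_rel]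
  and rel_antisym = antisymp_onD[OF antisymp_on_rel]

lemma maximal_above:
  assumes "x \<in> worlds M" "P x"
  obtains u where "u \<in> worlds M" "rel M x u" "P u"
    and "\<And>v. v \<in> worlds M \<Longrightarrow> rel M u v \<Longrightarrow> P v \<Longrightarrow> v = u"
proof -
  let ?strict = "\<lambda>u v. rel M u v \<and> u \<noteq> v"
  have "asymp_on (worlds M) ?strict" by (rule asymp_onI) (use rel_antisym in blast)
  moreover have "transp_on (worlds M) ?strict"
    by (rule transp_onI) (use rel_trans rel_antisym in blast)
  moreover have "\<exists>u\<in>worlds M. rel M x u \<and> P u" using assms rel_refl by blast
  ultimately obtain u where u: "u \<in> worlds M" "rel M x u" "P u"
    and max: "\<And>v. v \<in> worlds M \<Longrightarrow> ?strict u v \<Longrightarrow> \<not> (rel M x v \<and> P v)"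
    using Finite_Set.bex_max_element_with_property[OF finite_worlds,
        of ?strict "\<lambda>u. rel M x u \<and> P u"] by blast
  have "v = u" if "v \<in> worlds M" "rel M u v" "P v" for v
    using max[OF that(1)] that rel_trans[OF assms(1) u(1) that(1) u(2)] by blast
  with u show thesis using that by blast
qed

lemma Grz_axiom_frame_valid: "Grz_axiom \<in> frame_valid M"
  unfolding frame_valid_def
proof (intro CollectI allI ballI)
  fix V x assume x: "x \<in> worlds M"
  let ?N = "M\<lparr>val := V\<rparr>"
  show "?N, x \<Turnstile> Grz_axiom"
  proof (rule ccontr)
    assume "\<not> ?N, x \<Turnstile> Grz_axiom"
    then have "\<not> V x 0" and grz: "?N, x \<Turnstile> \<^bold>\<box> (\<^bold>\<box> (Var 0 \<^bold>\<rightarrow> \<^bold>\<box> (Var 0)) \<^bold>\<rightarrow> Var 0)"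
      by (auto simp: Grz_axiom_def)
    then obtain u where u: "u \<in> worlds M" "rel M x u" "\<not> V u 0"
      and max: "\<And>v. v \<in> worlds M \<Longrightarrow> rel M u v \<Longrightarrow> \<not> V v 0 \<Longrightarrow> v = u"
      using maximal_above[OF x, of "\<lambda>u. \<not> V u 0"] by blast
    from grz u have "\<not> ?N, u \<Turnstile> \<^bold>\<box> (Var 0 \<^bold>\<rightarrow> \<^bold>\<box> (Var 0))" by auto
    then obtain v z where v: "v \<in> worlds M" "rel M u v" "V v 0"
      and z: "z \<in> worlds M" "rel M v z" "\<not> V z 0" by auto
    have "z = u" using max z rel_trans u(1) v(1,2) by blast
    then have "v = u" using rel_antisym u(1) v(1,2) z(2) by blast
    with v(3) u(3) show False by simp
  qed
qed

lemma Grz_sound: "A \<in> Grz \<Longrightarrow> x \<in> worlds M \<Longrightarrow> M, x \<Turnstile> A"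
  by (rule frame_validD[OF subsetD[OF
        Grz_least[OF normal_logic_frame_valid Grz_axiom_frame_valid]]])

lemma sat_Box_mono:
  assumes "x \<in> worlds M" "y \<in> worlds M" "rel M x y" "M, x \<Turnstile> \<^bold>\<box> A"
  shows "M, y \<Turnstile> \<^bold>\<box> A"
  using assms rel_trans by (meson sat.simps(4))

end

lemma finite_poset_model_reflclp:
  assumes "finite (worlds M)" "rel M = R\<^sup>=\<^sup>=" "asymp_on (worlds M) R" "transp_on (worlds M) R"
  shows "finite_poset_model M"
  using assms
  by unfold_locales
    (simp_all only: reflp_on_reflclp transp_on_reflclp antisymp_on_reflclp_if_asymp_on)

locale Grz_extension = normal_modal_logic +
  assumes Grz_axiom_mem: "Grz_axiom \<in> L"
begin

lemma Grz_axiom_instance_mem: "\<^bold>\<box> (\<^bold>\<box> (A \<^bold>\<rightarrow> \<^bold>\<box> A) \<^bold>\<rightarrow> A) \<^bold>\<rightarrow> A \<in> L"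
  using subst_mem[OF Grz_axiom_mem, of "\<lambda>p. A"] by (simp add: Grz_axiom_def)

lemma T_mem: "\<^bold>\<box> A \<^bold>\<rightarrow> A \<in> L"
proof -
  have "A \<^bold>\<rightarrow> \<^bold>\<box> (A \<^bold>\<rightarrow> \<^bold>\<box> A) \<^bold>\<rightarrow> A \<in> L" by (rule tautology_mem) (simp add: tautology_def)
  then have "\<^bold>\<box> A \<^bold>\<rightarrow> \<^bold>\<box> (\<^bold>\<box> (A \<^bold>\<rightarrow> \<^bold>\<box> A) \<^bold>\<rightarrow> A) \<in> L" by (rule Box_mono_mem)
  with Grz_axiom_instance_mem show ?thesis
    unfolding proof_set_subset_iff[symmetric] by (rule order_trans[rotated])
qed

lemma four_mem: "\<^bold>\<box> A \<^bold>\<rightarrow> \<^bold>\<box> (\<^bold>\<box> A) \<in> L"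
proof -
  \<comment> \<open>\<open>E\<close> is \<open>A \<and> (\<box>A \<rightarrow> \<box>\<box>A)\<close>. Given \<open>A\<close>, both \<open>\<box>E\<close> and \<open>\<not>E\<close> imply \<open>\<box>A\<close>,
    so the Grz axiom for \<open>E\<close> applies under the hypothesis \<open>\<box>A\<close>.\<close>
  define E where "E = Conj [A, \<^bold>\<box> A \<^bold>\<rightarrow> \<^bold>\<box> (\<^bold>\<box> A)]"
  have E_iff: "E \<in> \<Gamma> \<longleftrightarrow> A \<in> \<Gamma> \<and> (\<^bold>\<box> A \<in> \<Gamma> \<longrightarrow> \<^bold>\<box> (\<^bold>\<box> A) \<in> \<Gamma>)"
    if "maximal_consistent \<Gamma>" for \<Gamma>
    using that by (simp add: E_def Conj_mem_maximal_consistent_iff maximal_consistent_simps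
        del: Conj.simps)
  note memI = mem_if_in_all_maximal_consistent and theoremD = maximal_consistent_Imp_theoremD
  have "E \<^bold>\<rightarrow> A \<in> L" by (rule memI) (simp add: E_iff maximal_consistent_simps)
  then have "\<^bold>\<box> E \<^bold>\<rightarrow> \<^bold>\<box> A \<in> L" by (rule Box_mono_mem)
  then have "(E \<^bold>\<rightarrow> \<^bold>\<box> E) \<^bold>\<rightarrow> (A \<^bold>\<rightarrow> \<^bold>\<box> A) \<in> L"
    by (intro memI) (auto simp: E_iff maximal_consistent_simps dest: theoremD)
  then have "\<^bold>\<box> (E \<^bold>\<rightarrow> \<^bold>\<box> E) \<^bold>\<rightarrow> \<^bold>\<box> (A \<^bold>\<rightarrow> \<^bold>\<box> A) \<in> L" by (rule Box_mono_mem)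
  then have "A \<^bold>\<rightarrow> \<^bold>\<box> (E \<^bold>\<rightarrow> \<^bold>\<box> E) \<^bold>\<rightarrow> E \<in> L"
    using K_mem[of A "\<^bold>\<box> A"]
    by (intro memI) (auto simp: E_iff maximal_consistent_simps dest: theoremD)
  then have "\<^bold>\<box> A \<^bold>\<rightarrow> \<^bold>\<box> (\<^bold>\<box> (E \<^bold>\<rightarrow> \<^bold>\<box> E) \<^bold>\<rightarrow> E) \<in> L" by (rule Box_mono_mem)
  then show ?thesis
    using Grz_axiom_instance_mem[of E]
    by (intro memI) (auto simp: E_iff maximal_consistent_simps dest: theoremD)
qed

lemma derives_Box_if_boxed_hypotheses:
  assumes "G \<subseteq> range Box"
  shows "G \<turnstile> A \<Longrightarrow> G \<turnstile> \<^bold>\<box> A"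
proof (induction rule: derives.induct)
  case (theorem_of A)
  then show ?case by (intro derives.theorem_of nec_mem)
next
  case (hypothesis A)
  then obtain B where "A = \<^bold>\<box> B" using assms by blast
  then show ?case
    using hypothesis modus_ponens[OF derives.theorem_of[OF four_mem] derives.hypothesis] by simp
next
  case (modus_ponens A B)
  then show ?case using derives.modus_ponens derives.theorem_of[OF K_mem] by blast
qed

lemma Box_countermodel:
  assumes \<Gamma>: "maximal_consistent \<Gamma>" and "\<^bold>\<box> D \<notin> \<Gamma>"
  obtains \<Delta> where "maximal_consistent \<Delta>" "D \<notin> \<Delta>" "\<^bold>\<box> (D \<^bold>\<rightarrow> \<^bold>\<box> D) \<in> \<Delta>" "Box -` \<Gamma> \<subseteq> Box -` \<Delta>"
proof -
  let ?S = "\<Gamma> \<inter> range Box"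
  let ?H = "insert (Neg D) (insert (\<^bold>\<box> (D \<^bold>\<rightarrow> \<^bold>\<box> D)) ?S)"
  have "consistent ?H"
    unfolding consistent_def
  proof
    assume "?H \<turnstile> \<^bold>\<bottom>"
    then have "?S \<turnstile> \<^bold>\<box> (D \<^bold>\<rightarrow> \<^bold>\<box> D) \<^bold>\<rightarrow> Neg (Neg D)" by (intro deduction_theorem)
    moreover have "?S \<turnstile> (\<^bold>\<box> (D \<^bold>\<rightarrow> \<^bold>\<box> D) \<^bold>\<rightarrow> Neg (Neg D)) \<^bold>\<rightarrow> \<^bold>\<box> (D \<^bold>\<rightarrow> \<^bold>\<box> D) \<^bold>\<rightarrow> D"
      by (rule derives_tautology) (simp add: tautology_def)
    ultimately have "?S \<turnstile> \<^bold>\<box> (D \<^bold>\<rightarrow> \<^bold>\<box> D) \<^bold>\<rightarrow> D" by (rule modus_ponens[rotated])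
    then have "?S \<turnstile> \<^bold>\<box> (\<^bold>\<box> (D \<^bold>\<rightarrow> \<^bold>\<box> D) \<^bold>\<rightarrow> D)"
      by (rule derives_Box_if_boxed_hypotheses[OF Int_lower2])
    then have "?S \<turnstile> D" by (rule modus_ponens[OF theorem_of[OF Grz_axiom_instance_mem]])
    then have "?S \<turnstile> \<^bold>\<box> D" by (rule derives_Box_if_boxed_hypotheses[OF Int_lower2])
    then have "\<Gamma> \<turnstile> \<^bold>\<box> D" by (rule derives_mono) simp
    then show False using maximal_consistent_closed[OF \<Gamma>] assms(2) by simp
  qed
  then obtain \<Delta> where \<Delta>: "?H \<subseteq> \<Delta>" "maximal_consistent \<Delta>" by (rule Lindenbaum)
  moreover from \<Delta> have "D \<notin> \<Delta>" by (auto simp: maximal_consistent_simps)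
  ultimately show thesis using that[of \<Delta>] by auto
qed

text \<open>The formulas \<open>\<box>(D \<rightarrow> \<box>D)\<close> separate a point from its successors that refute \<open>D\<close>.\<close>

definition Grz_closure :: "fm \<Rightarrow> fm set" where
  "Grz_closure A = Sub A \<union> (\<lambda>D. \<^bold>\<box> (D \<^bold>\<rightarrow> \<^bold>\<box> D)) ` (Box -` Sub A)"

definition canonical_model :: "fm \<Rightarrow> fm set kripke_model" where
  "canonical_model A =
    \<lparr>worlds = (\<lambda>\<Gamma>. \<Gamma> \<inter> Grz_closure A) ` Collect maximal_consistent,
     rel = (\<lambda>w u. Box -` w \<subset> Box -` u)\<^sup>=\<^sup>=,
     val = (\<lambda>w p. Var p \<in> w)\<rparr>"

lemma finite_Grz_closure: "finite (Grz_closure A)"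
  using finite_Sub finite_boxed_Sub by (simp add: Grz_closure_def vimage_def)

lemma finite_poset_canonical_model: "finite_poset_model (canonical_model A)"
proof (rule finite_poset_model_reflclp)
  show "finite (worlds (canonical_model A))"
    by (rule finite_subset[of _ "Pow (Grz_closure A)"])
      (auto simp: canonical_model_def finite_Grz_closure)
  show "rel (canonical_model A) = (\<lambda>w u. Box -` w \<subset> Box -` u)\<^sup>=\<^sup>="
    by (simp add: canonical_model_def)
  show "asymp_on (worlds (canonical_model A)) (\<lambda>w u. Box -` w \<subset> Box -` u)"
    by (rule asymp_onI) blast
  show "transp_on (worlds (canonical_model A)) (\<lambda>w u. Box -` w \<subset> Box -` u)"
    by (rule transp_onI) blast
qed

lemma Box_mem_iff_canonical_successors:
  assumes \<Gamma>: "maximal_consistent \<Gamma>" and D: "\<^bold>\<box> D \<in> Sub A"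
  shows "\<^bold>\<box> D \<in> \<Gamma> \<longleftrightarrow> (\<forall>\<Delta>. maximal_consistent \<Delta> \<longrightarrow>
    rel (canonical_model A) (\<Gamma> \<inter> Grz_closure A) (\<Delta> \<inter> Grz_closure A) \<longrightarrow> D \<in> \<Delta>)"
    (is "_ \<longleftrightarrow> (\<forall>\<Delta>. _ \<longrightarrow> ?sees \<Delta> \<longrightarrow> _)")
proof -
  have closure: "\<^bold>\<box> D \<in> Grz_closure A" "\<^bold>\<box> (D \<^bold>\<rightarrow> \<^bold>\<box> D) \<in> Grz_closure A"
    using D by (auto simp: Grz_closure_def)
  have Box_elim: "B \<in> \<Delta>" if "maximal_consistent \<Delta>" "\<^bold>\<box> B \<in> \<Delta>" for \<Delta> B
    by (rule maximal_consistent_Imp_theoremD[OF T_mem that])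
  show ?thesis
  proof (intro iffI allI impI)
    fix \<Delta> assume "\<^bold>\<box> D \<in> \<Gamma>" "maximal_consistent \<Delta>" "?sees \<Delta>"
    moreover from this have "\<^bold>\<box> D \<in> \<Delta>" using closure(1) by (auto simp: canonical_model_def)
    ultimately show "D \<in> \<Delta>" using Box_elim by blast
  next
    assume above: "\<forall>\<Delta>. maximal_consistent \<Delta> \<longrightarrow> ?sees \<Delta> \<longrightarrow> D \<in> \<Delta>"
    show "\<^bold>\<box> D \<in> \<Gamma>"
    proof (rule ccontr)
      assume not_box: "\<^bold>\<box> D \<notin> \<Gamma>"
      then obtain \<Delta> where \<Delta>: "maximal_consistent \<Delta>" "D \<notin> \<Delta>" "\<^bold>\<box> (D \<^bold>\<rightarrow> \<^bold>\<box> D) \<in> \<Delta>"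
        "Box -` \<Gamma> \<subseteq> Box -` \<Delta>" using Box_countermodel[OF \<Gamma>] by blast
      have "D \<in> \<Gamma>" using above \<Gamma> by (simp add: canonical_model_def)
      then have "D \<^bold>\<rightarrow> \<^bold>\<box> D \<notin> \<Gamma>" using not_box \<Gamma> by (simp add: maximal_consistent_simps)
      then have "\<^bold>\<box> (D \<^bold>\<rightarrow> \<^bold>\<box> D) \<notin> \<Gamma>" using Box_elim[OF \<Gamma>] by blast
      then have "Box -` (\<Gamma> \<inter> Grz_closure A) \<subset> Box -` (\<Delta> \<inter> Grz_closure A)"
        using \<Delta>(3,4) closure(2) by blast
      then have "D \<in> \<Delta>" using above \<Delta>(1) by (simp add: canonical_model_def)
      with \<Delta>(2) show False by simp
    qed
  qed
qed

lemma truth_lemma: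
  assumes "maximal_consistent \<Gamma>" "Sub C \<subseteq> Sub A"
  shows "canonical_model A, \<Gamma> \<inter> Grz_closure A \<Turnstile> C \<longleftrightarrow> C \<in> \<Gamma>"
  using assms
proof (induction C arbitrary: \<Gamma>)
  case (Var p)
  then show ?case by (auto simp: canonical_model_def Grz_closure_def)
next
  case (Box D)
  let ?K = "canonical_model A" and ?X = "Grz_closure A"
  have subformulas: "\<^bold>\<box> D \<in> Sub A" "Sub D \<subseteq> Sub A" using Box.prems(2) by auto
  have "?K, \<Gamma> \<inter> ?X \<Turnstile> \<^bold>\<box> D \<longleftrightarrow>
      (\<forall>\<Delta>. maximal_consistent \<Delta> \<longrightarrow> rel ?K (\<Gamma> \<inter> ?X) (\<Delta> \<inter> ?X) \<longrightarrow> ?K, \<Delta> \<inter> ?X \<Turnstile> D)"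
    by (auto simp: canonical_model_def)
  also have "\<dots> \<longleftrightarrow> \<^bold>\<box> D \<in> \<Gamma>"
    using Box.IH[OF _ subformulas(2)]
      Box_mem_iff_canonical_successors[OF Box.prems(1) subformulas(1)] by simp
  finally show ?case .
qed (simp_all add: maximal_consistent_simps)

end

interpretation Grz: Grz_extension Grz
  by unfold_locales (rule normal_logic_Grz Grz_axiom_in_Grz)+

theorem Grz_complete:
  assumes "A \<notin> Grz"
  obtains M :: "fm set kripke_model" and x
    where "finite_poset_model M" "x \<in> worlds M" "\<not> M, x \<Turnstile> A"
proof -
  obtain \<Gamma> where \<Gamma>: "Grz.maximal_consistent \<Gamma>" "A \<notin> \<Gamma>"
    using Grz.mem_if_in_all_maximal_consistent assms by blast
  let ?x = "\<Gamma> \<inter> Grz.Grz_closure A"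
  have "\<not> Grz.canonical_model A, ?x \<Turnstile> A" using Grz.truth_lemma[of \<Gamma> A A] \<Gamma> by simp
  moreover have "?x \<in> worlds (Grz.canonical_model A)"
    using \<Gamma>(1) by (simp add: Grz.canonical_model_def)
  ultimately show thesis using that Grz.finite_poset_canonical_model by blast
qed

section \<open>Directed simulations\<close>

lemma directed_bisimulation_sat:
  fixes M :: "'a kripke_model" and N :: "'b kripke_model"
  assumes pos: "\<And>x y p. Z x y \<Longrightarrow> p \<in> S \<Longrightarrow> val M x p \<Longrightarrow> val N y p"
    and neg: "\<And>x y p. Z x y \<Longrightarrow> p \<in> T \<Longrightarrow> val N y p \<Longrightarrow> val M x p"
    and zig: "\<And>x y x'. Z x y \<Longrightarrow> x' \<in> worlds M \<Longrightarrow> rel M x x' \<Longrightarrow>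
      \<exists>y'\<in>worlds N. rel N y y' \<and> Z x' y'"
    and zag: "\<And>x y y'. Z x y \<Longrightarrow> y' \<in> worlds N \<Longrightarrow> rel N y y' \<Longrightarrow>
      \<exists>x'\<in>worlds M. rel M x x' \<and> Z x' y'"
    and "Z x y" "vpos C \<subseteq> S" "vneg C \<subseteq> T" "M, x \<Turnstile> C"
  shows "N, y \<Turnstile> C"
proof -
  have "(vpos C \<subseteq> S \<longrightarrow> vneg C \<subseteq> T \<longrightarrow> M, x \<Turnstile> C \<longrightarrow> N, y \<Turnstile> C) \<and>
    (vpos C \<subseteq> T \<longrightarrow> vneg C \<subseteq> S \<longrightarrow> N, y \<Turnstile> C \<longrightarrow> M, x \<Turnstile> C)"
    using \<open>Z x y\<close>
  proof (induction C arbitrary: x y)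
    case (Var p)
    then show ?case using pos neg by auto
  next
    case (Imp C D)
    then show ?case by simp
  next
    case (Box C)
    have "N, y' \<Turnstile> C"
      if "vpos C \<subseteq> S" "vneg C \<subseteq> T" "M, x \<Turnstile> \<^bold>\<box> C" "y' \<in> worlds N" "rel N y y'" for y'
      using zag[OF Box.prems that(4,5)] Box.IH that(1-3) by auto
    moreover have "M, x' \<Turnstile> C"
      if "vpos C \<subseteq> T" "vneg C \<subseteq> S" "N, y \<Turnstile> \<^bold>\<box> C" "x' \<in> worlds M" "rel M x x'" for x'
      using zig[OF Box.prems that(4,5)] Box.IH that(1-3) by auto
    ultimately show ?case by simp
  qed simp
  then show ?thesis using assms(6-8) by blast
qed

definition layered_sim ::
    "nat \<Rightarrow> nat set \<Rightarrow> nat set \<Rightarrow> 'a kripke_model \<Rightarrow> 'a \<Rightarrow> 'b kripke_model \<Rightarrow> 'b \<Rightarrow> bool" where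
  "layered_sim k S T M x N y \<longleftrightarrow> (\<forall>C\<in>bounded_fms k S T. M, x \<Turnstile> C \<longrightarrow> N, y \<Turnstile> C)"

lemma layered_simD:
  "layered_sim k S T M x N y \<Longrightarrow> C \<in> bounded_fms k S T \<Longrightarrow> M, x \<Turnstile> C \<Longrightarrow> N, y \<Turnstile> C"
  by (simp add: layered_sim_def)

lemma layered_sim_antimono: "layered_sim l S T M x N y \<Longrightarrow> k \<le> l \<Longrightarrow> layered_sim k S T M x N y"
  using bounded_fms_mono[of k l S T] by (auto simp: layered_sim_def)

lemma layered_sim_converse:
  assumes "layered_sim k S T M x N y"
  shows "layered_sim k T S N y M x"
  unfolding layered_sim_def
proof (intro ballI impI)
  fix C assume "C \<in> bounded_fms k T S" "N, y \<Turnstile> C"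
  then show "M, x \<Turnstile> C" using layered_simD[OF assms, of "Neg C"] by auto
qed

lemma layered_sim_val: "layered_sim k S T M x N y \<Longrightarrow> p \<in> S \<Longrightarrow> val M x p \<Longrightarrow> val N y p"
  by (drule layered_simD[of _ _ _ _ _ _ _ "Var p"]) (auto simp: bounded_fms_def)

lemma layered_sim_forth:
  assumes sim: "layered_sim (Suc k) S T M x N y" and "finite (worlds N)"
    and x': "x' \<in> worlds M" "rel M x x'"
  obtains y' where "y' \<in> worlds N" "rel N y y'" "layered_sim k S T M x' N y'"
proof (rule ccontr)
  let ?Y = "{y' \<in> worlds N. rel N y y'}"
  assume "\<not> thesis"
  then have "\<forall>y'\<in>?Y. \<exists>C. C \<in> bounded_fms k S T \<and> M, x' \<Turnstile> C \<and> \<not> N, y' \<Turnstile> C"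
    using that by (auto simp: layered_sim_def)
  from bchoice[OF this] obtain sep where
    sep: "\<And>y'. y' \<in> ?Y \<Longrightarrow> sep y' \<in> bounded_fms k S T \<and> M, x' \<Turnstile> sep y' \<and> \<not> N, y' \<Turnstile> sep y'" by blast
  obtain Cs where Cs: "set Cs = sep ` ?Y" using finite_list[of "sep ` ?Y"] assms(2) by auto
  let ?D = "Neg (\<^bold>\<box> (Neg (Conj Cs)))"
  have "Conj Cs \<in> bounded_fms k S T" using sep Cs by (intro Conj_bounded_fms) auto
  then have "?D \<in> bounded_fms (Suc k) S T" by simp
  moreover have "M, x \<Turnstile> ?D" using sep Cs x' by auto
  ultimately have "N, y \<Turnstile> ?D" by (rule layered_simD[OF sim])
  then obtain y' where "y' \<in> ?Y" "N, y' \<Turnstile> Conj Cs" by auto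
  then show False using sep Cs by auto
qed

lemma layered_sim_back:
  assumes "layered_sim (Suc k) S T M x N y" "finite (worlds M)" "y' \<in> worlds N" "rel N y y'"
  obtains x' where "x' \<in> worlds M" "rel M x x'" "layered_sim k S T M x' N y'"
proof (rule layered_sim_forth[OF layered_sim_converse[OF assms(1)] assms(2-4)])
  fix x' assume "x' \<in> worlds M" "rel M x x'" "layered_sim k T S N y' M x'"
  then show thesis using that layered_sim_converse[of k T S N y' M x'] by simp
qed

lemma layered_sim_if_bounded_consequences:
  assumes N: "finite_poset_model N" "y \<in> worlds N" and fin: "finite S" "finite T"
    and consequences: "\<And>D. D \<in> bounded_fms k S T \<Longrightarrow> A \<^bold>\<rightarrow> D \<in> Grz \<Longrightarrow> N, y \<Turnstile> D"
  obtains M :: "fm set kripke_model" and x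
    where "finite_poset_model M" "x \<in> worlds M" "M, x \<Turnstile> A" "layered_sim k S T M x N y"
proof -
  let ?G = "{D \<in> bounded_fms k T S. N, y \<Turnstile> D}"
  obtain Cs where Cs: "set Cs \<subseteq> ?G" "\<And>D. D \<in> ?G \<Longrightarrow> Conj Cs \<^bold>\<rightarrow> D \<in> Grz"
    using Grz.finite_axiomatization_bounded_fms[OF fin(2,1), of ?G k] by blast
  have "Conj Cs \<in> bounded_fms k T S" using Cs(1) by (intro Conj_bounded_fms) blast
  moreover have "\<not> N, y \<Turnstile> Neg (Conj Cs)" using Cs(1) by auto
  ultimately have "A \<^bold>\<rightarrow> Neg (Conj Cs) \<notin> Grz" using consequences[of "Neg (Conj Cs)"] by auto
  then obtain M :: "fm set kripke_model" and x
    where M: "finite_poset_model M" "x \<in> worlds M" and "\<not> M, x \<Turnstile> A \<^bold>\<rightarrow> Neg (Conj Cs)"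
    by (rule Grz_complete)
  then have A: "M, x \<Turnstile> A" and C: "M, x \<Turnstile> Conj Cs" by simp_all
  have "layered_sim k T S N y M x"
    unfolding layered_sim_def
  proof (intro ballI impI)
    fix D assume "D \<in> bounded_fms k T S" "N, y \<Turnstile> D"
    then have "M, x \<Turnstile> Conj Cs \<^bold>\<rightarrow> D" using finite_poset_model.Grz_sound[OF M(1) Cs(2) M(2)] by simp
    with C show "M, x \<Turnstile> D" by (simp only: sat.simps)
  qed
  from that[OF M A layered_sim_converse[OF this]] show thesis .
qed

section \<open>Ranks and critical points\<close>

definition failing_boxes :: "'w kripke_model \<Rightarrow> fm \<Rightarrow> 'w \<Rightarrow> fm set" where
  "failing_boxes M A x = {C. \<^bold>\<box> C \<in> Sub A \<and> \<not> M, x \<Turnstile> \<^bold>\<box> C}"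

definition box_rank :: "'w kripke_model \<Rightarrow> fm \<Rightarrow> 'w \<Rightarrow> nat" where
  "box_rank M A x = card (failing_boxes M A x)"

definition critical :: "'w kripke_model \<Rightarrow> fm \<Rightarrow> 'w \<Rightarrow> bool" where
  "critical M A x \<longleftrightarrow>
     (\<forall>u\<in>worlds M. rel M x u \<longrightarrow> u \<noteq> x \<longrightarrow> failing_boxes M A u \<subset> failing_boxes M A x)"

lemma finite_failing_boxes: "finite (failing_boxes M A x)"
  by (rule finite_subset[OF _ finite_boxed_Sub[of A]]) (auto simp: failing_boxes_def)

lemma box_rank_le_nbox: "box_rank M A x \<le> nbox A"
  unfolding box_rank_def nbox_def failing_boxes_def by (rule card_mono[OF finite_boxed_Sub]) auto

lemma box_rank_strict_mono:
  "failing_boxes M A u \<subset> failing_boxes M A x \<Longrightarrow> box_rank M A u < box_rank M A x"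
  unfolding box_rank_def by (rule psubset_card_mono[OF finite_failing_boxes])

lemma box_rank_pos: "C \<in> failing_boxes M A x \<Longrightarrow> 0 < box_rank M A x"
  by (auto simp: box_rank_def card_gt_0_iff finite_failing_boxes)

context finite_poset_model
begin

lemma failing_boxes_antimono:
  "x \<in> worlds M \<Longrightarrow> u \<in> worlds M \<Longrightarrow> rel M x u \<Longrightarrow> failing_boxes M A u \<subseteq> failing_boxes M A x"
  unfolding failing_boxes_def using sat_Box_mono[of x u] by blast

lemma critical_refuting_point:
  assumes x: "x \<in> worlds M" and C: "C \<in> failing_boxes M A x"
  obtains u where "u \<in> worlds M" "rel M x u" "\<not> M, u \<Turnstile> C" "C \<in> failing_boxes M A u" "critical M A u"
proof -
  from C obtain z where z: "z \<in> worlds M" "rel M x z" "\<not> M, z \<Turnstile> C"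
    by (auto simp: failing_boxes_def)
  obtain u where u: "u \<in> worlds M" "rel M z u" "\<not> M, u \<Turnstile> C"
    and max: "\<And>v. v \<in> worlds M \<Longrightarrow> rel M u v \<Longrightarrow> \<not> M, v \<Turnstile> C \<Longrightarrow> v = u"
    using maximal_above[of z "\<lambda>u. \<not> M, u \<Turnstile> C"] z by blast
  have C_fails: "C \<in> failing_boxes M A u" using u C rel_refl by (auto simp: failing_boxes_def)
  have "failing_boxes M A v \<subset> failing_boxes M A u"
    if v: "v \<in> worlds M" "rel M u v" "v \<noteq> u" for v
  proof -
    have "M, t \<Turnstile> C" if t: "t \<in> worlds M" "rel M v t" for t
    proof (rule ccontr)
      assume "\<not> M, t \<Turnstile> C"
      then have "t = u" using max t(1) rel_trans[OF u(1) v(1) t(1) v(2) t(2)] by blast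
      then show False using rel_antisym u(1) v t(2) by blast
    qed
    then have "C \<notin> failing_boxes M A v" by (simp add: failing_boxes_def)
    then show ?thesis using C_fails failing_boxes_antimono[OF u(1) v(1,2), of A] by blast
  qed
  then have "critical M A u" by (simp add: critical_def)
  moreover have "rel M x u" using rel_trans[OF x z(1) u(1) z(2) u(2)] .
  ultimately show thesis using that u(1,3) C_fails by blast
qed

end

section \<open>Amalgamation\<close>

locale amalgamation = left: finite_poset_model M + right: finite_poset_model N
  for M :: "'a kripke_model" and N :: "'b kripke_model" +
  fixes A :: fm and P Q :: "nat set"
begin

abbreviation "failing \<equiv> failing_boxes M A"
abbreviation "rank \<equiv> box_rank M A"
abbreviation "sim k x y \<equiv> layered_sim k (vpos A - P) (vneg A - Q) M x N y"

text \<open>Let \<open>r = rank x\<close>. A pair \<open>(x, y)\<close> has level \<open>3r\<close> and its anchor \<open>(x\<^sub>0, y\<^sub>0)\<close> level \<open>3r + 1\<close>;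
  if the flag \<open>b\<close> is set, then the anchor is critical and the levels are \<open>3r - 2\<close> and \<open>3r - 1\<close>.
  A move of \<open>y\<close> is answered from the anchor, so moves that keep the failing boxes fixed can be
  repeated without consuming levels; a move that lowers the rank takes the anchor level from
  \<open>3r - 1\<close> to \<open>3(r - 1) + 1\<close> at worst. A failing box is refuted at a critical point, which takes the
  level from \<open>3r\<close> to the flagged anchor level \<open>3r - 1\<close> if the rank stays the same.\<close>

definition level :: "bool \<Rightarrow> 'a \<Rightarrow> nat" where
  "level b x = 3 * rank x - (if b then 2 else 0)"

lemma level_gt_if_failing_psubset: "failing u \<subset> failing x \<Longrightarrow> 3 * rank u < level b x"
  by (drule box_rank_strict_mono) (auto simp: level_def)

definition amalgam_worlds :: "('a \<times> 'b \<times> bool) set" where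
  "amalgam_worlds = {(x, y, b). x \<in> worlds M \<and> y \<in> worlds N \<and> sim (level b x) x y \<and>
     (\<exists>x\<^sub>0\<in>worlds M. \<exists>y\<^sub>0\<in>worlds N. rel M x\<^sub>0 x \<and> rel N y\<^sub>0 y \<and> failing x\<^sub>0 = failing x \<and>
       sim (Suc (level b x)) x\<^sub>0 y\<^sub>0 \<and> (b \<longrightarrow> critical M A x\<^sub>0))}"

fun precedes :: "'a \<times> 'b \<times> bool \<Rightarrow> 'a \<times> 'b \<times> bool \<Rightarrow> bool" where
  "precedes (x, y, b) (x', y', b') \<longleftrightarrow> rel N y y' \<and>
     (failing x' \<subset> failing x \<or> failing x' = failing x \<and> (b < b' \<or> b = b' \<and> y \<noteq> y'))"

fun amalgam_val :: "'a \<times> 'b \<times> bool \<Rightarrow> nat \<Rightarrow> bool" where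
  "amalgam_val (x, y, b) p \<longleftrightarrow> p \<in> vpos A \<and> val M x p \<or> p \<notin> Q \<and> val N y p"

definition amalgam :: "('a \<times> 'b \<times> bool) kripke_model" where
  "amalgam = \<lparr>worlds = amalgam_worlds, rel = precedes\<^sup>=\<^sup>=, val = amalgam_val\<rparr>"

lemma rel_amalgam: "rel amalgam = precedes\<^sup>=\<^sup>="
  by (simp add: amalgam_def)

lemma worlds_val_amalgam [simp]: "worlds amalgam = amalgam_worlds" "val amalgam = amalgam_val"
  by (simp_all add: amalgam_def)

lemma amalgam_worldsD:
  assumes "(x, y, b) \<in> amalgam_worlds"
  shows "x \<in> worlds M" "y \<in> worlds N" "sim (level b x) x y"
  using assms by (auto simp: amalgam_worlds_def)

lemma self_anchored_mem_amalgam_worlds: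
  assumes "x \<in> worlds M" "y \<in> worlds N" "sim (Suc (level b x)) x y" "b \<longrightarrow> critical M A x"
  shows "(x, y, b) \<in> amalgam_worlds"
proof -
  have "sim (level b x) x y" using assms(3) by (rule layered_sim_antimono) simp
  then show ?thesis using assms left.rel_refl right.rel_refl by (auto simp: amalgam_worlds_def)
qed

lemma finite_poset_amalgam: "finite_poset_model amalgam"
proof (rule finite_poset_model_reflclp)
  have "amalgam_worlds \<subseteq> worlds M \<times> worlds N \<times> UNIV" by (auto dest: amalgam_worldsD)
  then show "finite (worlds amalgam)"
    unfolding worlds_val_amalgam
    by (rule finite_subset) (simp add: left.finite_worlds right.finite_worlds)
  show "asymp_on (worlds amalgam) precedes"
  proof (rule asymp_onI)
    fix s t assume "s \<in> worlds amalgam" "t \<in> worlds amalgam" "precedes s t"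
    then show "\<not> precedes t s"
      using right.rel_antisym by (cases s; cases t) (auto dest!: amalgam_worldsD(2))
  qed
  show "transp_on (worlds amalgam) precedes"
  proof (rule transp_onI)
    fix s t u
    assume worlds: "s \<in> worlds amalgam" "t \<in> worlds amalgam" "u \<in> worlds amalgam"
      and st: "precedes s t" and tu: "precedes t u"
    obtain x y b x' y' b' x'' y'' b''
      where eqs: "s = (x, y, b)" "t = (x', y', b')" "u = (x'', y'', b'')" by (metis prod_cases3)
    have "y \<in> worlds N" "y' \<in> worlds N" "y'' \<in> worlds N"
      using worlds amalgam_worldsD(2) by (auto simp: eqs)
    moreover have "rel N y y'" "rel N y' y''" using st tu by (auto simp: eqs)
    ultimately have "rel N y y''" "y = y'' \<longrightarrow> y = y'"
      using right.rel_trans right.rel_antisym by blast+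
    then show "precedes s u" using st tu by (auto simp: eqs)
  qed
qed (rule rel_amalgam)

lemma amalgam_back:
  assumes world: "(x, y, b) \<in> amalgam_worlds" and y': "y' \<in> worlds N" "rel N y y'"
  obtains x' b' where "(x', y', b') \<in> amalgam_worlds" "rel amalgam (x, y, b) (x', y', b')"
proof (cases "y' = y")
  case True
  with world that show thesis by (simp add: rel_amalgam)
next
  case False
  from world obtain x\<^sub>0 y\<^sub>0 where anchor: "x\<^sub>0 \<in> worlds M" "y\<^sub>0 \<in> worlds N" "rel N y\<^sub>0 y"
    "failing x\<^sub>0 = failing x" "sim (Suc (level b x)) x\<^sub>0 y\<^sub>0" "b \<longrightarrow> critical M A x\<^sub>0"
    by (auto simp: amalgam_worlds_def)
  have "rel N y\<^sub>0 y'" using right.rel_trans anchor y' amalgam_worldsD(2)[OF world] by blast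
  then obtain x' where x': "x' \<in> worlds M" "rel M x\<^sub>0 x'" "sim (level b x) x' y'"
    using layered_sim_back[OF anchor(5) left.finite_worlds y'(1)] by blast
  have "failing x' \<subseteq> failing x"
    using left.failing_boxes_antimono[OF anchor(1) x'(1,2), of A] anchor(4) by simp
  then consider (same) "failing x' = failing x" | (fewer) "failing x' \<subset> failing x" by blast
  then show thesis
  proof cases
    case same
    then have "level b x' = level b x" by (simp add: level_def box_rank_def)
    then have "(x', y', b) \<in> amalgam_worlds"
      using anchor x' y'(1) \<open>rel N y\<^sub>0 y'\<close> same by (auto simp: amalgam_worlds_def)
    then show thesis using that y'(2) same False by (auto simp: rel_amalgam)
  next
    case fewer
    then have "Suc (level False x') \<le> level b x"
      using level_gt_if_failing_psubset[OF fewer] by (simp add: level_def Suc_le_eq)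
    then have "(x', y', False) \<in> amalgam_worlds"
      by (intro self_anchored_mem_amalgam_worlds layered_sim_antimono[OF x'(3)]) (use x' y' in auto)
    then show thesis using that y'(2) fewer by (auto simp: rel_amalgam)
  qed
qed

lemma amalgam_refuting_successor:
  assumes world: "(x, y, b) \<in> amalgam_worlds" and C: "C \<in> failing x"
  obtains x' y' b'
    where "(x', y', b') \<in> amalgam_worlds" "rel amalgam (x, y, b) (x', y', b')" "\<not> M, x' \<Turnstile> C"
proof -
  note xy = amalgam_worldsD[OF world]
  obtain u where u: "u \<in> worlds M" "rel M x u" "\<not> M, u \<Turnstile> C" "C \<in> failing u" "critical M A u"
    using left.critical_refuting_point[OF xy(1) C] .
  have "failing u \<subseteq> failing x" using left.failing_boxes_antimono[OF xy(1) u(1,2)] .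
  then consider (same) "failing u = failing x" b
    | (advance) "failing u \<subset> failing x \<or> failing u = failing x \<and> b < True" by auto
  then show thesis
  proof cases
    case same
    with world obtain x\<^sub>0 where x\<^sub>0: "x\<^sub>0 \<in> worlds M" "rel M x\<^sub>0 x"
      "failing x\<^sub>0 = failing x" "critical M A x\<^sub>0"
      by (auto simp: amalgam_worlds_def)
    have "rel M x\<^sub>0 u" using left.rel_trans[OF x\<^sub>0(1) xy(1) u(1) x\<^sub>0(2) u(2)] .
    then have "u = x\<^sub>0" using x\<^sub>0(3,4) u(1) same(1) unfolding critical_def by blast
    then have "u = x" using left.rel_antisym xy(1) u(1,2) x\<^sub>0(2) by blast
    then show thesis using that world u(3) by (simp add: rel_amalgam)
  next
    case advance
    have pos: "0 < rank u" using u(4) by (rule box_rank_pos)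
    from advance have "3 * rank u \<le> level b x"
    proof
      assume "failing u \<subset> failing x"
      then show ?thesis by (rule less_imp_le[OF level_gt_if_failing_psubset])
    qed (simp add: level_def box_rank_def)
    then have "Suc (Suc (level True u)) \<le> level b x" using pos by (simp add: level_def)
    then obtain y' where y': "y' \<in> worlds N" "rel N y y'" "sim (Suc (level True u)) u y'"
      using layered_sim_forth[OF layered_sim_antimono[OF xy(3)] right.finite_worlds u(1,2)] by blast
    have "(u, y', True) \<in> amalgam_worlds"
      using self_anchored_mem_amalgam_worlds u(1,5) y'(1,3) by blast
    moreover have "rel amalgam (x, y, b) (u, y', True)"
      using advance y'(2) by (auto simp: rel_amalgam)
    ultimately show thesis using that u(3) by blast
  qed
qed

lemma amalgam_rel_snd:
  "(x, y, b) \<in> amalgam_worlds \<Longrightarrow> rel amalgam (x, y, b) (x', y', b') \<Longrightarrow> rel N y y'"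
  using right.rel_refl amalgam_worldsD(2) by (auto simp: rel_amalgam)

lemma sat_amalgam_snd:
  assumes world: "(x, y, b) \<in> amalgam_worlds" and B: "vpos B \<inter> P = {}" "vneg B \<inter> Q = {}"
    and sat: "amalgam, (x, y, b) \<Turnstile> B"
  shows "N, y \<Turnstile> B"
proof -
  define Z where "Z s y \<longleftrightarrow> s \<in> amalgam_worlds \<and> (\<exists>x b. s = (x, y, b))" for s y
  show ?thesis
  proof (rule directed_bisimulation_sat[where Z = Z and M = amalgam and S = "- P" and T = "- Q"])
    fix s y p assume "Z s y" "p \<in> - P" "val amalgam s p"
    then show "val N y p" using layered_sim_val[OF amalgam_worldsD(3)] by (auto simp: Z_def)
  next
    fix s y p assume "Z s y" "p \<in> - Q" "val N y p"
    then show "val amalgam s p" by (auto simp: Z_def)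
  next
    fix s y s' assume "Z s y" and s': "s' \<in> worlds amalgam" "rel amalgam s s'"
    then obtain x b where s: "s = (x, y, b)" "(x, y, b) \<in> amalgam_worlds" by (auto simp: Z_def)
    obtain x' y' b' where eq: "s' = (x', y', b')" by (rule prod_cases3)
    have "y' \<in> worlds N" "Z s' y'" using s'(1) amalgam_worldsD(2) by (auto simp: eq Z_def)
    moreover have "rel N y y'" using amalgam_rel_snd[OF s(2)] s'(2) unfolding s(1) eq .
    ultimately show "\<exists>y'\<in>worlds N. rel N y y' \<and> Z s' y'" by blast
  next
    fix s y y' assume "Z s y" and y': "y' \<in> worlds N" "rel N y y'"
    then obtain x b where s: "s = (x, y, b)" "(x, y, b) \<in> amalgam_worlds" by (auto simp: Z_def)
    from amalgam_back[OF s(2) y'] obtain x' b'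
      where "(x', y', b') \<in> amalgam_worlds" "rel amalgam s (x', y', b')" unfolding s(1) .
    then show "\<exists>s'\<in>worlds amalgam. rel amalgam s s' \<and> Z s' y'" by (auto simp: Z_def)
  qed (use world B sat in \<open>auto simp: Z_def\<close>)
qed

lemma sat_amalgam_fst:
  assumes "(x, y, b) \<in> amalgam_worlds" "Sub C \<subseteq> Sub A"
  shows "(vpos C \<subseteq> vpos A \<longrightarrow> vneg C \<subseteq> vneg A \<longrightarrow> M, x \<Turnstile> C \<longrightarrow> amalgam, (x, y, b) \<Turnstile> C) \<and>
    (vpos C \<subseteq> vneg A \<longrightarrow> vneg C \<subseteq> vpos A \<longrightarrow> amalgam, (x, y, b) \<Turnstile> C \<longrightarrow> M, x \<Turnstile> C)"
  using assms
proof (induction C arbitrary: x y b)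
  case (Var p)
  have "val M x p" if "p \<in> vneg A" "p \<notin> Q" "val N y p"
    using layered_sim_val[OF layered_sim_converse[OF amalgam_worldsD(3)[OF Var.prems(1)]]] that
    by simp
  then show ?case by auto
next
  case (Imp C D)
  then show ?case by simp
next
  case (Box C)
  have "amalgam, (x', y', b') \<Turnstile> C"
    if polarity: "vpos C \<subseteq> vpos A" "vneg C \<subseteq> vneg A" and boxC: "M, x \<Turnstile> \<^bold>\<box> C"
      and s': "(x', y', b') \<in> amalgam_worlds" "rel amalgam (x, y, b) (x', y', b')" for x' y' b'
  proof -
    have "failing x' \<subseteq> failing x" using s'(2) by (auto simp: rel_amalgam)
    then have "M, x' \<Turnstile> \<^bold>\<box> C" using boxC Box.prems(2) by (auto simp: failing_boxes_def)
    then have "M, x' \<Turnstile> C" using amalgam_worldsD(1)[OF s'(1)] left.rel_refl by auto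
    then show ?thesis using Box.IH[OF s'(1)] Box.prems(2) polarity by simp
  qed
  moreover have "M, x \<Turnstile> \<^bold>\<box> C"
    if polarity: "vpos C \<subseteq> vneg A" "vneg C \<subseteq> vpos A" and boxC: "amalgam, (x, y, b) \<Turnstile> \<^bold>\<box> C"
  proof (rule ccontr)
    assume "\<not> M, x \<Turnstile> \<^bold>\<box> C"
    then have "C \<in> failing x" using Box.prems(2) by (simp add: failing_boxes_def)
    then obtain x' y' b' where s': "(x', y', b') \<in> amalgam_worlds"
      "rel amalgam (x, y, b) (x', y', b')" and "\<not> M, x' \<Turnstile> C"
      using amalgam_refuting_successor[OF Box.prems(1)] by blast
    then show False using Box.IH[OF s'(1)] Box.prems(2) polarity boxC by simp
  qed
  ultimately show ?case by auto
qed simp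

lemma Imp_notin_Grz_if_layered_sim:
  assumes "x \<in> worlds M" "y \<in> worlds N" "sim (3 * nbox A + 1) x y" "M, x \<Turnstile> A"
    and "vpos B \<inter> P = {}" "vneg B \<inter> Q = {}" "\<not> N, y \<Turnstile> B"
  shows "A \<^bold>\<rightarrow> B \<notin> Grz"
proof
  assume valid: "A \<^bold>\<rightarrow> B \<in> Grz"
  have "Suc (level False x) \<le> 3 * nbox A + 1" using box_rank_le_nbox by (simp add: level_def)
  then have world: "(x, y, False) \<in> amalgam_worlds"
    using layered_sim_antimono[OF assms(3)] assms(1,2)
    by (intro self_anchored_mem_amalgam_worlds) simp_all
  then have "amalgam, (x, y, False) \<Turnstile> A" using sat_amalgam_fst[OF world] assms(4) by simp
  moreover have "amalgam, (x, y, False) \<Turnstile> A \<^bold>\<rightarrow> B"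
    using finite_poset_model.Grz_sound[OF finite_poset_amalgam valid] world by simp
  ultimately have "amalgam, (x, y, False) \<Turnstile> B" by simp
  then show False using sat_amalgam_snd[OF world assms(5,6)] assms(7) by simp
qed

end

section \<open>The interpolant\<close>

theorem ex_uniform_Lyndon_interpolant_Grz:
  obtains C where "uniform_Lyndon_interpolant Grz A P Q C" "mdepth C \<le> 3 * nbox A + 1"
proof -
  let ?S = "vpos A - P" and ?T = "vneg A - Q" and ?k = "3 * nbox A + 1"
  have fin: "finite ?S" "finite ?T" using finite_vpos_vneg by simp_all
  obtain C where C: "C \<in> bounded_fms ?k ?S ?T" "A \<^bold>\<rightarrow> C \<in> Grz"
    and strongest: "\<And>D. D \<in> bounded_fms ?k ?S ?T \<Longrightarrow> A \<^bold>\<rightarrow> D \<in> Grz \<Longrightarrow> C \<^bold>\<rightarrow> D \<in> Grz"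
    using Grz.strongest_bounded_consequence[OF fin, of ?k A] by blast
  have "C \<^bold>\<rightarrow> B \<in> Grz" if B: "vpos B \<inter> P = {}" "vneg B \<inter> Q = {}" "A \<^bold>\<rightarrow> B \<in> Grz" for B
  proof (rule ccontr)
    assume "C \<^bold>\<rightarrow> B \<notin> Grz"
    then obtain N :: "fm set kripke_model" and y
      where N: "finite_poset_model N" "y \<in> worlds N" and "\<not> N, y \<Turnstile> C \<^bold>\<rightarrow> B" by (rule Grz_complete)
    then have yC: "N, y \<Turnstile> C" and yB: "\<not> N, y \<Turnstile> B" by simp_all
    have "N, y \<Turnstile> D" if "D \<in> bounded_fms ?k ?S ?T" "A \<^bold>\<rightarrow> D \<in> Grz" for D
      using finite_poset_model.Grz_sound[OF N(1) strongest[OF that] N(2)] yC by simp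
    then obtain M :: "fm set kripke_model" and x where M: "finite_poset_model M" "x \<in> worlds M"
      "M, x \<Turnstile> A" "layered_sim ?k ?S ?T M x N y"
      using layered_sim_if_bounded_consequences[OF N fin] by blast
    interpret amalgamation M N A P Q using M(1) N(1) by (simp add: amalgamation_def)
    show False using Imp_notin_Grz_if_layered_sim[OF M(2) N(2) M(4,3) B(1,2) yB] B(3) by simp
  qed
  with C have "uniform_Lyndon_interpolant Grz A P Q C"
    by (simp add: uniform_Lyndon_interpolant_def bounded_fms_def)
  with C(1) show thesis using that by (simp add: bounded_fms_def)
qed

theorem theorem5p3:
  shows "uniform_Lyndon_interpolation Grz \<and>
    (\<forall>(A::fm) (P::nat set) (Q::nat set). finite P \<longrightarrow> finite Q \<longrightarrow>
       (\<exists>C. uniform_Lyndon_interpolant Grz A P Q C \<and> mdepth C \<le> 3 * nbox A + 3))"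
proof -
  have "\<exists>C. uniform_Lyndon_interpolant Grz A P Q C \<and> mdepth C \<le> 3 * nbox A + 3" for A P Q
  proof -
    obtain C where "uniform_Lyndon_interpolant Grz A P Q C" "mdepth C \<le> 3 * nbox A + 1"
      by (rule ex_uniform_Lyndon_interpolant_Grz)
    then show ?thesis by (intro exI[of _ C]) simp
  qed
  then show ?thesis unfolding uniform_Lyndon_interpolation_def by blast
qed

end
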